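(* Let $N\ge 2$ be an integer, $\kappa_N=(-1)^{N-1}$, let $a<b$ be real numbers, let $\lambda>0$, and let $\varphi$ be an $(N-1)$ times differentiable function on $\mathbb{R}$. Assume that the Feynman-Kac functional $\Phi(x)=\mathbb{E}_x\big(\mathrm{e}^{-\lambda\tau_{ab}}\varphi(X_{\tau_{ab}})\mathbf{1}_{\{\tau_{ab}<+\infty\}}\big)$, $x\in(a,b)$ (defined in the context), solves the boundary value problem $$\kappa_N\Phi^{(2N)}(x)=\lambda\,\Phi(x),\ x\in(a,b),\qquad \Phi^{(k)}(a)=\varphi^{(k)}(a),\quad \Phi^{(k)}(b)=\varphi^{(k)}(b)\quad\text{for }0\le k\le N-1 .$$ Then for all $x\in(a,b)$, $$\mathbb{E}_x\big(\mathrm{e}^{-\lambda\tau_{ab}}\varphi(X_{\tau_{ab}})\mathbf{1}_{\{\tau_{ab}<+\infty\}}\big)=\sum_{k=0}^{N-1}\lambda^{-\frac{k}{2N}}\frac{\Delta_k^-(\lambda;x)}{\Delta(\lambda)}\,\varphi^{(k)}(a)+\sum_{k=0}^{N-1}\lambda^{-\frac{k}{2N}}\frac{\Delta_k^+(\lambda;x)}{\Delta(\lambda)}\,\varphi^{(k)}(b),$$ where $\Delta(\lambda)$ and $\Delta_k^{\pm}(\lambda;x)$ are the $2N\times 2N$ determinants defined in the context. Moreover, for each $k\in\{0,\dots,N-1\}$, the functions $x\mapsto\Delta_k^{\pm}(\lambda;x)$ are the solutions of the boundary value problems (derivatives being taken with respect to $x$) $$(\Delta_k^-)^{(2N)}(\lambda;x)=\kappa_N\lambda\,\Delta_k^-(\lambda;x),\quad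 (\Delta_k^-)^{(\ell)}(\lambda;a)=\delta_{k\ell}\,\lambda^{\ell/(2N)}\Delta(\lambda),\quad (\Delta_k^-)^{(\ell)}(\lambda;b)=0\quad\text{for }\ell\in\{0,\dots,N-1\},$$ $$(\Delta_k^+)^{(2N)}(\lambda;x)=\kappa_N\lambda\,\Delta_k^+(\lambda;x),\quad (\Delta_k^+)^{(\ell)}(\lambda;a)=0,\quad (\Delta_k^+)^{(\ell)}(\lambda;b)=\delta_{k\ell}\,\lambda^{\ell/(2N)}\Delta(\lambda)\quad\text{for }\ell\in\{0,\dots,N-1\}.$$
   Context: Pseudo-process. For $t>0$, $p(t;\cdot)$ is the function with $\int_{-\infty}^{+\infty}\mathrm{e}^{\mathrm{i}ux}p(t;x)\,\mathrm{d}x=\mathrm{e}^{-tu^{2N}}$ (a signed kernel), and $p(t;x,y)=p(t;x-y)$. The pseudo-process $(X_t)_{t\ge0}$ started at $x$ has the signed finite-dimensional distributions $\mathbb{P}_x\{X_{t_1}\in\mathrm{d}x_1,\dots,X_{t_n}\in\mathrm{d}x_n\}=\prod_{k=1}^n p(t_k-t_{k-1};x_{k-1},x_k)\,\mathrm{d}x_1\cdots\mathrm{d}x_n$ for $0=t_0<t_1<\dots<t_n$, $x_0=x$. Feynman-Kac functional. $\tau_{ab}=\inf\{t\ge0:X_t\notin(a,b)\}$ is approximated by $\tau_{ab,n}=2^{-n}\min\{k\in\mathbb{N}:X_{k/2^n}\notin(a,b)\}$. For $\lambda\ge0$ and $x\in(a,b)$, $$\Phi_n(x)=\mathbb{E}_x\big(\mathrm{e}^{-\lambda\tau_{ab,n}}\varphi(X_{\tau_{ab,n}})\mathbf{1}_{\{\tau_{ab,n}<+\infty\}}\big)=\sum_{k\ge1}\mathrm{e}^{-\lambda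 k/2^n}\int_{(a,b)^{k-1}\times(\mathbb{R}\setminus(a,b))}\varphi(x_k)\prod_{j=1}^k p(2^{-n};x_{j-1},x_j)\,\mathrm{d}x_1\cdots\mathrm{d}x_k\quad(x_0=x),$$ and by definition $\mathbb{E}_x\big(\mathrm{e}^{-\lambda\tau_{ab}}\varphi(X_{\tau_{ab}})\mathbf{1}_{\{\tau_{ab}<+\infty\}}\big)=\Phi(x)=\lim_{n\to\infty}\Phi_n(x)$ (the limit being assumed to exist). In the boundary value problem, values of $\Phi$ and its derivatives at $a$, $b$ are one-sided limits from inside $(a,b)$. Determinants. $\theta_\ell=\mathrm{e}^{\mathrm{i}\frac{2\ell+N-1}{2N}\pi}$ for $1\le\ell\le2N$ (the $2N$-th roots of $\kappa_N$), and $e_\lambda^z=\mathrm{e}^{\lambda^{1/(2N)}z}$ for $z\in\mathbb{C}$. $\Delta(\lambda)$ is the determinant of the $2N\times2N$ matrix whose $(j+1)$-th row is $(\theta_\ell^j e_\lambda^{\theta_\ell a})_{1\le\ell\le2N}$ and whose $(N+j+1)$-th row is $(\theta_\ell^j e_\lambda^{\theta_\ell b})_{1\le\ell\le2N}$, for $0\le j\le N-1$. For $0\le k\le N-1$, $\Delta_k^-(\lambda;x)$ (resp. $\Delta_k^+(\lambda;x)$) is the determinant of the matrix obtained from that one by replacing its $(k+1)$-th row (resp. its $(N+k+1)$-th row) by $(e_\lambda^{\theta_\ell x})_{1\le\ell\le2N}$. $\delta_{k\ell}$ is the Kronecker symbol. *)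

theory Defs
  imports "HOL-Analysis.Analysis" "Jordan_Normal_Form.Determinant"
begin

definition kap :: "nat \<Rightarrow> real" where
  "kap N = (- 1) ^ (N - 1)"

text \<open>
  Derivatives of functions of a real variable with complex values. On an open set, being
  \<open>n\<close> times differentiable means that the derivatives of order below \<open>n\<close> are differentiable;
  the values of the function outside the open set are irrelevant.
\<close>

definition nderiv :: "nat \<Rightarrow> (real \<Rightarrow> complex) \<Rightarrow> real \<Rightarrow> complex" where
  "nderiv n f = ((\<lambda>g x. vector_derivative g (at x)) ^^ n) f"

definition ndiff_on :: "nat \<Rightarrow> (real \<Rightarrow> complex) \<Rightarrow> real set \<Rightarrow> bool" where
  "ndiff_on n f S \<longleftrightarrow> (\<forall>k<n. \<forall>x\<in>S. nderiv k f differentiable at x)"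

text \<open>
  The kernel \<open>p(t;x)\<close> is written \<open>p t x\<close>. Integrability and continuity make it uniquely
  determined by its Fourier transform for every \<open>t > 0\<close>.
\<close>

definition is_kernel :: "nat \<Rightarrow> (real \<Rightarrow> real \<Rightarrow> real) \<Rightarrow> bool" where
  "is_kernel N p \<longleftrightarrow> (\<forall>t>0.
     continuous_on UNIV (p t) \<and> integrable lborel (p t) \<and>
     (\<forall>u::real. (LINT x|lborel. exp (\<i> * of_real (u * x)) * complex_of_real (p t x))
        = of_real (exp (- t * u ^ (2 * N)))))"

text \<open>
  Joint density of \<open>(X_h, X_{2h}, \<dots>, X_{kh})\<close> at \<open>(y 1, \<dots>, y k)\<close> for the
  pseudo-process started at \<open>x\<close>; the update \<open>y(0 := x)\<close> realises the convention \<open>x_0 = x\<close>.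
\<close>

definition step_density :: "(real \<Rightarrow> real \<Rightarrow> real) \<Rightarrow> real \<Rightarrow> real \<Rightarrow> nat \<Rightarrow> (nat \<Rightarrow> real) \<Rightarrow> real" where
  "step_density p h x k y = (\<Prod>j=1..k. p h ((y(0 := x)) (j - 1) - y j))"

text \<open>The set \<open>(a,b)^{k-1} \<times> (\<real> - (a,b))\<close> with coordinates indexed by \<open>1, \<dots>, k\<close>.\<close>

definition exit_set :: "real \<Rightarrow> real \<Rightarrow> nat \<Rightarrow> (nat \<Rightarrow> real) set" where
  "exit_set a b k = (\<Pi>\<^sub>E j\<in>{1..k}. if j < k then {a<..<b} else - {a<..<b})"

definition exit_term ::
  "(real \<Rightarrow> real \<Rightarrow> real) \<Rightarrow> real \<Rightarrow> real \<Rightarrow> real \<Rightarrow> (real \<Rightarrow> complex) \<Rightarrow> nat \<Rightarrow> real \<Rightarrow> nat \<Rightarrow> complex" where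
  "exit_term p a b lam \<phi> n x k =
     of_real (exp (- lam * real k / 2 ^ n)) *
     (LINT y:exit_set a b k|Pi\<^sub>M {1..k} (\<lambda>_. lborel).
        \<phi> (y k) * of_real (step_density p (1 / 2 ^ n) x k y))"

definition fk_approx ::
  "(real \<Rightarrow> real \<Rightarrow> real) \<Rightarrow> real \<Rightarrow> real \<Rightarrow> real \<Rightarrow> (real \<Rightarrow> complex) \<Rightarrow> nat \<Rightarrow> real \<Rightarrow> complex" where
  "fk_approx p a b lam \<phi> n x = (\<Sum>k. exit_term p a b lam \<phi> n x (Suc k))"

definition feynman_kac ::
  "(real \<Rightarrow> real \<Rightarrow> real) \<Rightarrow> real \<Rightarrow> real \<Rightarrow> real \<Rightarrow> (real \<Rightarrow> complex) \<Rightarrow> real \<Rightarrow> complex" where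
  "feynman_kac p a b lam \<phi> x = lim (\<lambda>n. fk_approx p a b lam \<phi> n x)"

text \<open>
  The integrals, the series and the limit entering \<open>feynman_kac\<close> are total operations;
  the following predicate says that they are all meaningful at \<open>x\<close>.
\<close>

definition feynman_kac_exists ::
  "(real \<Rightarrow> real \<Rightarrow> real) \<Rightarrow> real \<Rightarrow> real \<Rightarrow> real \<Rightarrow> (real \<Rightarrow> complex) \<Rightarrow> real \<Rightarrow> bool" where
  "feynman_kac_exists p a b lam \<phi> x \<longleftrightarrow>
     (\<forall>n. \<forall>k\<ge>1. set_integrable (Pi\<^sub>M {1..k} (\<lambda>_. lborel)) (exit_set a b k)
        (\<lambda>y. \<phi> (y k) * of_real (step_density p (1 / 2 ^ n) x k y))) \<and>
     (\<forall>n. summable (\<lambda>k. exit_term p a b lam \<phi> n x (Suc k))) \<and>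
     convergent (\<lambda>n. fk_approx p a b lam \<phi> n x)"

text \<open>
  \<open>\<alpha> k\<close> and \<open>\<beta> k\<close> are the prescribed one-sided limits, from inside the interval, of the
  \<open>k\<close>-th derivative at \<open>a\<close> and \<open>b\<close>.
\<close>

definition solves_bvp ::
  "nat \<Rightarrow> real \<Rightarrow> real \<Rightarrow> real \<Rightarrow> (nat \<Rightarrow> complex) \<Rightarrow> (nat \<Rightarrow> complex) \<Rightarrow> (real \<Rightarrow> complex) \<Rightarrow> bool" where
  "solves_bvp N lam a b \<alpha> \<beta> u \<longleftrightarrow>
     ndiff_on (2 * N) u {a<..<b} \<and>
     (\<forall>x\<in>{a<..<b}. of_real (kap N) * nderiv (2 * N) u x = of_real lam * u x) \<and>
     (\<forall>k<N. (nderiv k u \<longlongrightarrow> \<alpha> k) (at_right a) \<and> (nderiv k u \<longlongrightarrow> \<beta> k) (at_left b))"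

definition theta :: "nat \<Rightarrow> nat \<Rightarrow> complex" where
  "theta N l = exp (\<i> * of_real ((2 * real l + real N - 1) / (2 * real N) * pi))"

definition e_lam :: "nat \<Rightarrow> real \<Rightarrow> complex \<Rightarrow> complex" where
  "e_lam N lam z = exp (of_real (lam powr (1 / (2 * real N))) * z)"

text \<open>
  Matrix indices start at 0: row \<open>i < N\<close> belongs to the power \<open>j = i\<close> at \<open>a\<close>, row
  \<open>N + j\<close> to the power \<open>j\<close> at \<open>b\<close>, and column \<open>c\<close> to the root with number \<open>\<ell> = c + 1\<close>.
\<close>

definition Delta_mat :: "nat \<Rightarrow> real \<Rightarrow> real \<Rightarrow> real \<Rightarrow> complex mat" where
  "Delta_mat N a b lam = Matrix.mat (2 * N) (2 * N) (\<lambda>(i, c).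
     if i < N then theta N (Suc c) ^ i * e_lam N lam (theta N (Suc c) * of_real a)
     else theta N (Suc c) ^ (i - N) * e_lam N lam (theta N (Suc c) * of_real b))"

definition Delta_mat_repl :: "nat \<Rightarrow> real \<Rightarrow> real \<Rightarrow> real \<Rightarrow> nat \<Rightarrow> real \<Rightarrow> complex mat" where
  "Delta_mat_repl N a b lam r x = Matrix.mat (2 * N) (2 * N) (\<lambda>(i, c).
     if i = r then e_lam N lam (theta N (Suc c) * of_real x)
     else Delta_mat N a b lam $$ (i, c))"

definition Delta :: "nat \<Rightarrow> real \<Rightarrow> real \<Rightarrow> real \<Rightarrow> complex" where
  "Delta N a b lam = Determinant.det (Delta_mat N a b lam)"

definition Delta_minus :: "nat \<Rightarrow> real \<Rightarrow> real \<Rightarrow> real \<Rightarrow> nat \<Rightarrow> real \<Rightarrow> complex" where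
  "Delta_minus N a b lam k x = Determinant.det (Delta_mat_repl N a b lam k x)"

definition Delta_plus :: "nat \<Rightarrow> real \<Rightarrow> real \<Rightarrow> real \<Rightarrow> nat \<Rightarrow> real \<Rightarrow> complex" where
  "Delta_plus N a b lam k x = Determinant.det (Delta_mat_repl N a b lam (N + k) x)"

definition kron :: "nat \<Rightarrow> nat \<Rightarrow> complex" where
  "kron k l = (if k = l then 1 else 0)"

end

theory Submission
  imports Defs
begin

text \<open>
  The theorem is uniqueness for a linear boundary value problem, combined with Cramer's rule.

  Put \<open>w = lam powr (1 / (2 * N))\<close>. The \<open>2 * N\<close> numbers \<open>r\<^sub>l = w * \<theta>\<^sub>l\<close> are the roots of
  \<open>z ^ (2 * N) = \<kappa>\<^sub>N * lam\<close>, so every exponential sum \<open>\<Sum>l. c\<^sub>l * exp (r\<^sub>l * x)\<close> solves the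
  differential equation, and conversely every solution on an interval has this form
  (\<open>solution_is_exp_sum\<close>). A solution therefore extends smoothly beyond the end points, and its
  one-sided boundary values are ordinary derivatives there.

  A solution \<open>U\<close> whose derivatives of order below \<open>N\<close> vanish at both \<open>a\<close> and \<open>b\<close> is zero
  (\<open>zero_boundary_data_imp_zero\<close>). Informally, multiply the equation by the conjugate of \<open>U\<close> and
  integrate by parts \<open>N\<close> times; the sign \<open>\<kappa>\<^sub>N = (-1) ^ (N - 1)\<close> is the one for which the outcome is
  \<open>\<integral> (lam * \<bar>U\<bar>\<^sup>2 + \<bar>U\<^sup>(\<^sup>N\<^sup>)\<bar>\<^sup>2) = 0\<close>. Since the exponentials are linearly independent
  (\<open>exp_sum_coeff_zero\<close>), all coefficients of \<open>U\<close> are then zero.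

  Up to factors \<open>w ^ k\<close>, the rows of the matrix behind \<open>\<Delta>\<close> map the coefficients of an exponential
  sum to its boundary data. Hence this matrix has trivial kernel and \<open>\<Delta> \<noteq> 0\<close>. Expanding
  \<open>\<Delta>\<^sub>k\<^sup>-(x)\<close> and \<open>\<Delta>\<^sub>k\<^sup>+(x)\<close> along the replaced row exhibits them as exponential sums whose
  coefficients are cofactors, and their boundary data are entries of the product of the matrix
  with its adjugate, that is \<open>\<Delta>\<close> or \<open>0\<close> up to a power of \<open>w\<close>. The right-hand side of the
  representation formula is thus an exponential sum with the same boundary data as the
  Feynman-Kac functional, and uniqueness (\<open>bvp_solution_unique\<close>) identifies the two.
\<close>

section \<open>Iterated derivatives\<close>

lemma nderiv_0 [simp]: "nderiv 0 f = f"
  by (simp add: nderiv_def)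

lemma nderiv_Suc: "nderiv (Suc k) f x = vector_derivative (nderiv k f) (at x)"
  by (simp add: nderiv_def)

lemma ndiff_on_has_vector_derivative:
  assumes "ndiff_on n u S" "k < n" "x \<in> S"
  shows "(nderiv k u has_vector_derivative nderiv (Suc k) u x) (at x)"
  using assms by (simp add: ndiff_on_def nderiv_Suc vector_derivative_works [symmetric])

lemma nderiv_eq_of_chain:
  assumes "open S"
    and "\<And>k x. x \<in> S \<Longrightarrow> (U k has_vector_derivative U (Suc k) x) (at x)"
    and "\<And>x. x \<in> S \<Longrightarrow> u x = U 0 x"
    and "x \<in> S"
  shows "nderiv k u x = U k x"
  using \<open>x \<in> S\<close>
proof (induction k arbitrary: x)
  case 0
  then show ?case using assms(3) by simp
next
  case (Suc k)
  have "(nderiv k u has_vector_derivative U (Suc k) x) (at x)"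
    by (rule has_vector_derivative_transform_within_open[OF assms(2)[OF Suc.prems] assms(1) Suc.prems])
       (simp add: Suc.IH)
  then show ?case by (simp add: nderiv_Suc vector_derivative_at)
qed

section \<open>Exponential sums and the equation \<open>u\<^sup>(\<^sup>n\<^sup>) = \<rho>\<^sup>n u\<close>\<close>

text \<open>
  The roots of \<open>z ^ n = \<rho> ^ n\<close> are \<open>\<rho> * \<omega> ^ l\<close> for a primitive \<open>n\<close>-th root of unity \<open>\<omega>\<close>. This
  parametrisation makes every sum of powers of roots, and of powers of quotients of roots, a
  geometric one.
\<close>

locale binomial_ode =
  fixes n :: nat and \<rho> \<omega> :: complex
  assumes n_pos: "0 < n" and \<rho>_nonzero: "\<rho> \<noteq> 0"
    and \<omega>_root: "\<omega> ^ n = 1" and \<omega>_primitive: "\<And>m. 0 < m \<Longrightarrow> m < n \<Longrightarrow> \<omega> ^ m \<noteq> 1"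
begin

definition char_root :: "nat \<Rightarrow> complex" where
  "char_root l = \<rho> * \<omega> ^ l"

text \<open>
  The index \<open>k\<close> is the order of differentiation, so that one family describes a solution
  together with all its derivatives.
\<close>

definition exp_sum :: "(nat \<Rightarrow> complex) \<Rightarrow> nat \<Rightarrow> real \<Rightarrow> complex" where
  "exp_sum c k x = (\<Sum>l<n. c l * char_root l ^ k * exp (char_root l * of_real x))"

lemma \<omega>_nonzero: "\<omega> \<noteq> 0"
  using \<omega>_root n_pos by (auto simp: power_0_left)

lemma char_root_nonzero: "char_root l \<noteq> 0"
  by (simp add: char_root_def \<rho>_nonzero \<omega>_nonzero)

lemma char_root_power: "char_root l ^ n = \<rho> ^ n"
proof -
  have "(\<omega> ^ l) ^ n = 1" by (metis \<omega>_root power_mult mult.commute power_one)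
  then show ?thesis by (simp add: char_root_def power_mult_distrib)
qed

lemma sum_roots_power_zero:
  assumes "z \<noteq> 1" "z ^ n = 1"
  shows "(\<Sum>l<n. z ^ l) = (0::complex)"
  using geometric_sum[OF assms(1), of n] assms(2) by simp

lemma sum_char_root_power:
  assumes "0 < m" "m < n"
  shows "(\<Sum>l<n. char_root l ^ m) = 0"
proof -
  have "(\<Sum>l<n. char_root l ^ m) = \<rho> ^ m * (\<Sum>l<n. (\<omega> ^ m) ^ l)"
    by (simp add: char_root_def power_mult_distrib sum_distrib_left power_mult [symmetric] mult.commute)
  moreover have "(\<omega> ^ m) ^ n = 1" by (metis \<omega>_root power_mult mult.commute power_one)
  ultimately show ?thesis using sum_roots_power_zero[of "\<omega> ^ m"] \<omega>_primitive[OF assms] by simp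
qed

lemma char_root_inj:
  assumes "l < n" "m < n" "char_root l = char_root m"
  shows "l = m"
  using assms
proof (induction l m rule: linorder_wlog)
  case (le l m)
  then have "\<omega> ^ l = \<omega> ^ m" by (simp add: char_root_def \<rho>_nonzero)
  also have "\<omega> ^ m = \<omega> ^ l * \<omega> ^ (m - l)" using le by (simp flip: power_add)
  finally have "\<omega> ^ (m - l) = 1" using \<omega>_nonzero by simp
  then show ?case using \<omega>_primitive[of "m - l"] le by fastforce
next
  case (sym l m)
  then show ?case by simp
qed

lemma exp_sum_derivative:
  "(exp_sum c k has_vector_derivative exp_sum c (Suc k) x) (at x)"
proof -
  have e: "((\<lambda>x::real. exp (z * of_real x)) has_vector_derivative z * exp (z * of_real x)) (at x)"
    for z :: complex
    by (rule has_vector_derivative_real_field[where f="\<lambda>y. exp (z * y)"])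
       (auto intro!: derivative_eq_intros)
  have "((\<lambda>x. \<Sum>l<n. (c l * char_root l ^ k) * exp (char_root l * of_real x)) has_vector_derivative
     (\<Sum>l<n. (c l * char_root l ^ k) * (char_root l * exp (char_root l * of_real x)))) (at x)"
    by (intro has_vector_derivative_sum has_vector_derivative_mult_right e)
  then show ?thesis by (simp add: exp_sum_def [abs_def] mult_ac)
qed

lemma isCont_exp_sum: "isCont (exp_sum c k) x"
  using exp_sum_derivative has_vector_derivative_continuous by blast

lemma nderiv_exp_sum: "nderiv k (exp_sum c 0) = exp_sum c k"
  by (rule ext, rule nderiv_eq_of_chain[of UNIV]) (auto intro: exp_sum_derivative)

lemma ndiff_on_exp_sum: "ndiff_on k (exp_sum c 0) S"
  unfolding ndiff_on_def nderiv_exp_sum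
  using exp_sum_derivative differentiableI_vector by blast

lemma exp_sum_periodic: "exp_sum c (k + n) x = \<rho> ^ n * exp_sum c k x"
  by (simp add: exp_sum_def power_add char_root_power sum_distrib_left mult_ac)

lemma exp_sum_add: "exp_sum (\<lambda>l. c l + d l) k x = exp_sum c k x + exp_sum d k x"
  by (simp add: exp_sum_def sum.distrib algebra_simps)

lemma exp_sum_diff: "exp_sum (\<lambda>l. c l - d l) k x = exp_sum c k x - exp_sum d k x"
  by (simp add: exp_sum_def sum_subtractf algebra_simps)

lemma exp_sum_linear_combination:
  "exp_sum (\<lambda>l. \<Sum>i\<in>I. s i * d i l) k x = (\<Sum>i\<in>I. s i * exp_sum (d i) k x)"
  unfolding exp_sum_def sum_distrib_left sum_distrib_right
  by (subst sum.swap) (simp add: mult_ac)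

text \<open>
  Linear independence of the exponentials. With \<open>d\<^sub>l = c\<^sub>l * exp (r\<^sub>l * x)\<close>, vanishing of the
  derivatives at the single point \<open>x\<close> says \<open>\<Sum>l. d\<^sub>l * r\<^sub>l ^ j = 0\<close> for every \<open>j\<close>. Weighting by
  \<open>r\<^sub>m ^ (- j)\<close> and summing over \<open>j < n\<close> leaves \<open>n * d\<^sub>m\<close>, because \<open>r\<^sub>l / r\<^sub>m\<close> is an \<open>n\<close>-th
  root of unity different from \<open>1\<close> for \<open>l \<noteq> m\<close>.
\<close>

lemma exp_sum_coeff_zero:
  assumes "\<And>j. exp_sum c j x = 0" "m < n"
  shows "c m = 0"
proof -
  define d where "d l = c l * exp (char_root l * of_real x)" for l
  have inner: "(\<Sum>j<n. (char_root l / char_root m) ^ j) = (if l = m then of_nat n else 0)"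
    if "l < n" for l
  proof (cases "l = m")
    case True
    then show ?thesis using char_root_nonzero by simp
  next
    case False
    then have "char_root l / char_root m \<noteq> 1"
      using char_root_inj[OF that \<open>m < n\<close>] char_root_nonzero by (metis divide_eq_1_iff)
    moreover have "(char_root l / char_root m) ^ n = 1"
      using \<rho>_nonzero by (simp add: power_divide char_root_power)
    ultimately show ?thesis using False sum_roots_power_zero by simp
  qed
  have "0 = (\<Sum>j<n. exp_sum c j x / char_root m ^ j)"
    using assms(1) by simp
  also have "\<dots> = (\<Sum>l<n. d l * (\<Sum>j<n. (char_root l / char_root m) ^ j))"
    unfolding exp_sum_def sum_distrib_left sum_divide_distrib
    by (subst sum.swap) (simp add: d_def power_divide mult_ac)
  also have "\<dots> = (\<Sum>l<n. if l = m then d l * of_nat n else 0)"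
    by (intro sum.cong) (auto simp: inner)
  also have "\<dots> = d m * of_nat n"
    using \<open>m < n\<close> by (simp add: sum.delta)
  finally show ?thesis using n_pos by (simp add: d_def)
qed

text \<open>
  Each root \<open>r\<close> yields a first integral: \<open>q = \<Sum>j<n. r ^ (n - 1 - j) * u\<^sup>(\<^sup>j\<^sup>)\<close> satisfies
  \<open>q' - r * q = u\<^sup>(\<^sup>n\<^sup>) - r ^ n * u = 0\<close>, so \<open>exp (- r * x) * q x\<close> is constant. Summing \<open>r * q\<close>
  over all roots eliminates the derivatives of orders \<open>1, \<dots>, n - 1\<close>, whose coefficients are the
  vanishing power sums of the roots, and leaves \<open>n * \<rho> ^ n * u\<close>.
\<close>

lemma solution_is_exp_sum:
  assumes diff: "ndiff_on n u {a<..<b}"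
    and ode: "\<And>x. x \<in> {a<..<b} \<Longrightarrow> nderiv n u x = \<rho> ^ n * u x"
  obtains c where "\<And>x. x \<in> {a<..<b} \<Longrightarrow> u x = exp_sum c 0 x"
proof -
  define q where "q l x = (\<Sum>j<n. char_root l ^ (n - Suc j) * nderiv j u x)" for l x
  define v where "v l x = exp (- char_root l * of_real x) * q l x" for l and x :: real
  have dv: "(v l has_vector_derivative 0) (at x)" if x: "x \<in> {a<..<b}" for l x
  proof -
    define r where "r = char_root l"
    have dq: "(q l has_vector_derivative (\<Sum>j<n. r ^ (n - Suc j) * nderiv (Suc j) u x)) (at x)"
      unfolding q_def [abs_def] r_def
      by (intro has_vector_derivative_sum has_vector_derivative_mult_right
          ndiff_on_has_vector_derivative[OF diff _ x]) auto
    have de: "((\<lambda>x::real. exp (- r * of_real x)) has_vector_derivative (- r * exp (- r * of_real x))) (at x)"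
      by (rule has_vector_derivative_real_field[where f="\<lambda>y. exp (- r * y)"])
         (auto intro!: derivative_eq_intros)
    have "(\<Sum>j<n. r ^ (n - Suc j) * nderiv (Suc j) u x) - r * q l x
        = (\<Sum>j<n. r ^ (n - Suc j) * nderiv (Suc j) u x - r ^ (n - j) * nderiv j u x)"
      unfolding q_def sum_distrib_left sum_subtractf r_def
      by (intro arg_cong2[of _ _ _ _ "(-)"] refl sum.cong)
         (auto simp: power_Suc [symmetric] mult.assoc [symmetric] Suc_diff_Suc simp del: power_Suc)
    also have "\<dots> = nderiv n u x - r ^ n * u x"
      using sum_lessThan_telescope[of "\<lambda>j. r ^ (n - j) * nderiv j u x" n] by simp
    also have "\<dots> = 0" using ode[OF x] by (simp add: r_def char_root_power)
    finally have z: "(\<Sum>j<n. r ^ (n - Suc j) * nderiv (Suc j) u x) = r * q l x" by simp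
    show ?thesis
      using has_vector_derivative_mult[OF de dq] by (simp add: v_def [abs_def] z flip: r_def)
  qed
  have "\<exists>d. \<forall>x\<in>{a<..<b}. v l x = d" for l
    using has_vector_derivative_zero_constant[of "{a<..<b}" "v l"] dv
    by (metis convex_real_interval(8) has_vector_derivative_at_within)
  then obtain d where d: "\<And>l x. x \<in> {a<..<b} \<Longrightarrow> v l x = d l" by metis
  \<comment> \<open>only the term with \<open>j = 0\<close> survives the sum over the roots, as \<open>n - j\<close> lies strictly between
    \<open>0\<close> and \<open>n\<close> for all others\<close>
  have "u x = exp_sum (\<lambda>l. char_root l * d l / (of_nat n * \<rho> ^ n)) 0 x" if x: "x \<in> {a<..<b}" for x
  proof -
    have q: "q l x = d l * exp (char_root l * of_real x)" for l
      using d[OF x, of l] by (auto simp: v_def exp_minus field_simps)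
    have "(\<Sum>l<n. char_root l * q l x)
        = (\<Sum>j<n. (\<Sum>l<n. char_root l ^ (n - j)) * nderiv j u x)"
      unfolding q_def sum_distrib_left sum_distrib_right
      by (subst sum.swap)
         (auto intro!: sum.cong simp: power_Suc [symmetric] mult.assoc [symmetric] Suc_diff_Suc simp del: power_Suc)
    also have "\<dots> = (\<Sum>j<n. if j = 0 then of_nat n * \<rho> ^ n * u x else 0)"
      by (intro sum.cong) (auto simp: sum_char_root_power char_root_power)
    also have "\<dots> = of_nat n * \<rho> ^ n * u x" using n_pos by (simp add: sum.delta)
    finally show ?thesis
      using n_pos \<rho>_nonzero
      by (simp add: exp_sum_def q mult.assoc flip: sum_divide_distrib)
  qed
  then show ?thesis using that by blast
qed

section \<open>The energy identity and uniqueness\<close>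

text \<open>
  Integration by parts in differential form: the boundary terms are collected in
  \<open>E = \<Sum>j<N. (-1) ^ j * U\<^sup>(\<^sup>n\<^sup>-\<^sup>1\<^sup>-\<^sup>j\<^sup>) * cnj U\<^sup>(\<^sup>j\<^sup>)\<close>. Its derivative telescopes, and for the sign of
  \<open>\<rho> ^ n\<close> assumed here \<open>(-1) ^ (N - 1) * E\<close> has derivative \<open>lam * \<bar>U\<bar>\<^sup>2 + \<bar>U\<^sup>(\<^sup>N\<^sup>)\<bar>\<^sup>2 \<ge> 0\<close>.
  Every summand of \<open>E\<close> contains a derivative of order below \<open>N\<close>, so \<open>E\<close> vanishes at \<open>a\<close> and
  at \<open>b\<close>; being monotone up to sign, it vanishes in between, and so does \<open>U\<close>.
\<close>

lemma zero_boundary_data_imp_zero: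
  assumes n: "n = 2 * N" and "lam > 0" and \<rho>: "\<rho> ^ n = (- 1) ^ (N - 1) * of_real lam" and "a < b"
    and bdry: "\<And>k. k < N \<Longrightarrow> exp_sum c k a = 0" "\<And>k. k < N \<Longrightarrow> exp_sum c k b = 0"
    and "m < n"
  shows "c m = 0"
proof -
  have N: "N > 0" using n n_pos by simp
  define U where "U = exp_sum c"
  define E where "E x = (\<Sum>j<N. (- 1) ^ j * (U (n - Suc j) x * cnj (U j x)))" for x
  have dU: "(U k has_vector_derivative U (Suc k) x) (at x)" for k x
    unfolding U_def by (rule exp_sum_derivative)
  have dE: "(E has_vector_derivative (- 1) ^ (N - 1) * of_real (lam * (cmod (U 0 x))\<^sup>2 + (cmod (U N x))\<^sup>2)) (at x)"
    for x
  proof -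
    define g where "g j = (- 1) ^ j * (U (n - j) x * cnj (U j x))" for j
    have "(E has_vector_derivative
        (\<Sum>j<N. (- 1) ^ j * (U (n - Suc j) x * cnj (U (Suc j) x) + U (Suc (n - Suc j)) x * cnj (U j x)))) (at x)"
      unfolding E_def [abs_def]
      by (intro has_vector_derivative_sum has_vector_derivative_mult_right
          has_vector_derivative_mult has_vector_derivative_cnj dU)
    also have "(\<Sum>j<N. (- 1) ^ j * (U (n - Suc j) x * cnj (U (Suc j) x) + U (Suc (n - Suc j)) x * cnj (U j x)))
        = (\<Sum>j<N. g j - g (Suc j))"
      by (intro sum.cong) (auto simp: g_def n Suc_diff_Suc algebra_simps)
    also have "\<dots> = g 0 - g N" by (rule sum_lessThan_telescope')
    also have "g 0 = (- 1) ^ (N - 1) * of_real (lam * (cmod (U 0 x))\<^sup>2)"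
      using exp_sum_periodic[of c 0 x] by (simp add: g_def U_def \<rho> mult.assoc complex_norm_square del: of_real_power)
    also have "g N = - ((- 1) ^ (N - 1) * of_real ((cmod (U N x))\<^sup>2))"
      using N by (cases N) (simp_all add: g_def n complex_norm_square del: of_real_power)
    finally show ?thesis by (simp add: algebra_simps)
  qed
  define F where "F x = Re ((- 1) ^ (N - 1) * E x)" for x
  have dF: "(F has_real_derivative lam * (cmod (U 0 x))\<^sup>2 + (cmod (U N x))\<^sup>2) (at x)" for x
  proof -
    have s: "(- 1) ^ (N - 1) * ((- 1) ^ (N - 1) * z) = z" for z :: complex
      by (simp flip: mult.assoc power_mult_distrib)
    show ?thesis
      using bounded_linear.has_vector_derivative[OF bounded_linear_Re
          has_vector_derivative_mult_right[OF dE, of "(- 1) ^ (N - 1)"]]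
      unfolding s by (simp add: F_def [abs_def] has_real_derivative_iff_has_vector_derivative)
  qed
  have F0: "F a = 0" "F b = 0" using bdry by (simp_all add: F_def E_def U_def)
  have mono: "F x \<le> F y" if "x \<le> y" for x y
    by (rule DERIV_nonneg_imp_nondecreasing[OF that]) (use dF \<open>lam > 0\<close> in \<open>force\<close>)
  have Fz: "F x = 0" if "x \<in> {a<..<b}" for x
    using mono[of a x] mono[of x b] that F0 by auto
  have U0: "U 0 x = 0" if x: "x \<in> {a<..<b}" for x
  proof -
    have "(F has_real_derivative 0) (at x)"
      by (rule has_field_derivative_transform_within_open[of "\<lambda>_. 0" 0 x "{a<..<b}"])
         (use x Fz in auto)
    from DERIV_unique[OF this dF]
    have "lam * (cmod (U 0 x))\<^sup>2 + (cmod (U N x))\<^sup>2 = 0" by simp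
    moreover have "lam * (cmod (U 0 x))\<^sup>2 \<ge> 0" using \<open>lam > 0\<close> by simp
    ultimately have "lam * (cmod (U 0 x))\<^sup>2 = 0" by (smt (verit) zero_le_power2)
    then show ?thesis using \<open>lam > 0\<close> by simp
  qed
  \<comment> \<open>any interior point serves to extract the coefficients, as all derivatives vanish there\<close>
  define x where "x = (a + b) / 2"
  have x: "x \<in> {a<..<b}" using \<open>a < b\<close> by (simp add: x_def)
  have "U k x = 0" for k
    using nderiv_eq_of_chain[of "{a<..<b}" U "\<lambda>_. 0" x k] nderiv_eq_of_chain[of UNIV "\<lambda>_ _. 0" "\<lambda>_. 0" x k]
      dU U0 x by simp
  then show ?thesis using exp_sum_coeff_zero[of c x m] \<open>m < n\<close> by (simp add: U_def)
qed

text \<open>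
  The solution \<open>u\<close> is prescribed on the open interval only. Its exponential representation is
  smooth on the whole line, which turns the one-sided limits into derivatives at the end points;
  the difference of two representations then has zero boundary data.
\<close>

lemma bvp_solution_unique:
  assumes n: "n = 2 * N" and "lam > 0" and \<rho>: "\<rho> ^ n = (- 1) ^ (N - 1) * of_real lam" and "a < b"
    and bvp: "solves_bvp N lam a b \<alpha> \<beta> u"
    and bdry: "\<And>k. k < N \<Longrightarrow> exp_sum c k a = \<alpha> k" "\<And>k. k < N \<Longrightarrow> exp_sum c k b = \<beta> k"
    and x: "x \<in> {a<..<b}"
  shows "u x = exp_sum c 0 x"
proof -
  have sq: "(- 1) ^ (N - 1) * ((- 1) ^ (N - 1) * z) = z" for z :: complex
    by (simp flip: mult.assoc power_mult_distrib)
  have ode: "nderiv n u y = \<rho> ^ n * u y" if "y \<in> {a<..<b}" for y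
  proof -
    have "(- 1) ^ (N - 1) * nderiv n u y = of_real lam * u y"
      using bvp that by (simp add: solves_bvp_def kap_def n)
    then show ?thesis by (metis sq \<rho> mult.assoc)
  qed
  obtain d where d: "\<And>y. y \<in> {a<..<b} \<Longrightarrow> u y = exp_sum d 0 y"
    using solution_is_exp_sum[of u a b, OF _ ode] bvp n unfolding solves_bvp_def by blast
  have nd: "nderiv k u y = exp_sum d k y" if "y \<in> {a<..<b}" for k y
    by (rule nderiv_eq_of_chain[of "{a<..<b}"]) (use d that exp_sum_derivative in auto)
  have da: "exp_sum d k a = \<alpha> k" if "k < N" for k
  proof (rule tendsto_unique)
    show "(exp_sum d k \<longlongrightarrow> exp_sum d k a) (at_right a)"
      using isCont_exp_sum[where c=d and k=k and x=a] by (simp add: isCont_def filterlim_at_split)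
    have "(nderiv k u \<longlongrightarrow> \<alpha> k) (at_right a)" using bvp that by (simp add: solves_bvp_def)
    then show "(exp_sum d k \<longlongrightarrow> \<alpha> k) (at_right a)"
      by (rule Lim_transform_eventually)
         (use nd \<open>a < b\<close> in \<open>auto simp: eventually_at_right_field intro!: exI[of _ b]\<close>)
  qed simp
  have db: "exp_sum d k b = \<beta> k" if "k < N" for k
  proof (rule tendsto_unique)
    show "(exp_sum d k \<longlongrightarrow> exp_sum d k b) (at_left b)"
      using isCont_exp_sum[where c=d and k=k and x=b] by (simp add: isCont_def filterlim_at_split)
    have "(nderiv k u \<longlongrightarrow> \<beta> k) (at_left b)" using bvp that by (simp add: solves_bvp_def)
    then show "(exp_sum d k \<longlongrightarrow> \<beta> k) (at_left b)"
      by (rule Lim_transform_eventually)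
         (use nd \<open>a < b\<close> in \<open>auto simp: eventually_at_left_field intro!: exI[of _ a]\<close>)
  qed simp
  have "d l - c l = 0" if "l < n" for l
    by (rule zero_boundary_data_imp_zero[OF n \<open>lam > 0\<close> \<rho> \<open>a < b\<close>, of "\<lambda>l. d l - c l"])
       (use that in \<open>simp_all add: exp_sum_diff da db bdry\<close>)
  then have "exp_sum d 0 x = exp_sum c 0 x" by (simp add: exp_sum_def)
  then show ?thesis using d[OF x] by simp
qed

end

section \<open>Cofactors\<close>

text \<open>
  Laplace expansion along the replaced row: the cofactors of that row do not see the
  replacement.
\<close>

lemma det_replace_row:
  fixes A :: "complex mat"
  assumes A: "A \<in> carrier_mat n n" and r: "r < n"
  shows "Determinant.det (Matrix.mat n n (\<lambda>(i, c). if i = r then v c else A $$ (i, c)))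
    = (\<Sum>c<n. v c * cofactor A r c)" (is "Determinant.det ?B = _")
proof -
  have "mat_delete ?B r c = mat_delete A r c" if "c < n" for c
    using A that r by (intro eq_matI) (auto simp: mat_delete_def)
  then have "cofactor ?B r c = cofactor A r c" if "c < n" for c
    using that by (simp add: cofactor_def)
  then show ?thesis
    using laplace_expansion_row[of ?B n r] r by simp
qed

text \<open>
  Expansion along a row with the cofactors of a possibly different row, read off from
  \<open>A * adj A = det A\<close>.
\<close>

lemma sum_row_cofactor:
  fixes A :: "complex mat"
  assumes A: "A \<in> carrier_mat n n" and i: "i < n" and r: "r < n"
  shows "(\<Sum>c<n. A $$ (i, c) * cofactor A r c) = (if i = r then Determinant.det A else 0)"
proof -
  have "(A * adj_mat A) $$ (i, r) = (\<Sum>c<n. A $$ (i, c) * cofactor A r c)"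
    using A i r by (simp add: scalar_prod_def adj_mat_def atLeast0LessThan)
  then show ?thesis using adj_mat(2)[OF A] i r by (auto split: if_splits)
qed

section \<open>The characteristic roots of the boundary value problem\<close>

lemma binomial_ode_theta:
  assumes "N > 0" "lam > 0"
  shows "binomial_ode (2 * N) (of_real (lam powr (1 / (2 * real N))) * theta N 1)
    (exp (2 * of_real pi * \<i> / of_nat (2 * N)))"
proof
  let ?w = "exp (2 * of_real pi * \<i> / of_nat (2 * N))"
  have w: "?w ^ m = exp (2 * of_real pi * \<i> * of_nat m / of_nat (2 * N))" for m
    by (simp flip: exp_of_nat_mult add: mult_ac)
  show "0 < 2 * N" using assms by simp
  show "of_real (lam powr (1 / (2 * real N))) * theta N 1 \<noteq> 0"
    using assms by (simp add: theta_def)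
  show "?w ^ (2 * N) = 1"
    unfolding w using assms complex_root_unity_eq_1[of "2 * N" "2 * N"] by simp
  show "?w ^ m \<noteq> 1" if "0 < m" "m < 2 * N" for m
    unfolding w using that assms complex_root_unity_eq_1[of "2 * N" m] by (auto dest: dvd_imp_le)
qed

lemma theta_Suc:
  assumes "N > 0"
  shows "theta N (Suc l) = theta N 1 * exp (2 * of_real pi * \<i> / of_nat (2 * N)) ^ l"
  unfolding theta_def exp_of_nat_mult [symmetric] exp_add [symmetric]
  using assms by (intro arg_cong[of _ _ exp]) (simp add: field_simps)

lemma theta_power:
  assumes "N > 0"
  shows "theta N 1 ^ (2 * N) = (- 1) ^ (N - 1)"
proof -
  have "theta N 1 ^ (2 * N) = exp (of_nat (N - 1) * (\<i> * of_real pi) + 2 * of_real pi * \<i>)"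
    unfolding theta_def exp_of_nat_mult [symmetric]
    using assms by (intro arg_cong[of _ _ exp]) (simp add: field_simps of_nat_diff)
  also have "\<dots> = exp (\<i> * of_real pi) ^ (N - 1)"
    by (simp only: exp_add exp_of_nat_mult exp_two_pi_i mult_1_right)
  finally show ?thesis by simp
qed

text \<open>
  With \<open>A\<close> the matrix behind \<open>\<Delta>\<close> and \<open>C r\<close> the cofactors of its row \<open>r\<close>, the exponential sum
  with coefficients \<open>C r\<close> is the determinant with row \<open>r\<close> replaced. Rows \<open>k\<close> and \<open>N + k\<close> give
  \<open>\<Delta>\<^sub>k\<^sup>-\<close> and \<open>\<Delta>\<^sub>k\<^sup>+\<close>, so both families are treated at once.
\<close>

theorem theorem1:
  fixes N :: nat and a b lam :: real
    and p :: "real \<Rightarrow> real \<Rightarrow> real" and \<phi> :: "real \<Rightarrow> complex"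
  assumes "N \<ge> 2" and "a < b" and "lam > 0"
    and "is_kernel N p"
    and "ndiff_on (N - 1) \<phi> UNIV"
    and "\<forall>x\<in>{a<..<b}. feynman_kac_exists p a b lam \<phi> x"
    and "solves_bvp N lam a b (\<lambda>k. nderiv k \<phi> a) (\<lambda>k. nderiv k \<phi> b) (feynman_kac p a b lam \<phi>)"
  shows "Delta N a b lam \<noteq> 0
    \<and> (\<forall>x\<in>{a<..<b}. feynman_kac p a b lam \<phi> x =
         (\<Sum>k=0..N-1. of_real (lam powr (- (real k / (2 * real N))))
            * (Delta_minus N a b lam k x / Delta N a b lam) * nderiv k \<phi> a)
       + (\<Sum>k=0..N-1. of_real (lam powr (- (real k / (2 * real N))))
            * (Delta_plus N a b lam k x / Delta N a b lam) * nderiv k \<phi> b))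
    \<and> (\<forall>k\<in>{0..N-1}.
         ndiff_on (2 * N) (Delta_minus N a b lam k) UNIV
       \<and> (\<forall>x. nderiv (2 * N) (Delta_minus N a b lam k) x
                = of_real (kap N * lam) * Delta_minus N a b lam k x)
       \<and> (\<forall>l\<in>{0..N-1}.
             nderiv l (Delta_minus N a b lam k) a
               = kron k l * of_real (lam powr (real l / (2 * real N))) * Delta N a b lam
           \<and> nderiv l (Delta_minus N a b lam k) b = 0)
       \<and> (\<forall>u. solves_bvp N lam a b
               (\<lambda>l. kron k l * of_real (lam powr (real l / (2 * real N))) * Delta N a b lam)
               (\<lambda>l. 0) u
             \<longrightarrow> (\<forall>x\<in>{a<..<b}. u x = Delta_minus N a b lam k x)))
    \<and> (\<forall>k\<in>{0..N-1}.
         ndiff_on (2 * N) (Delta_plus N a b lam k) UNIV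
       \<and> (\<forall>x. nderiv (2 * N) (Delta_plus N a b lam k) x
                = of_real (kap N * lam) * Delta_plus N a b lam k x)
       \<and> (\<forall>l\<in>{0..N-1}.
             nderiv l (Delta_plus N a b lam k) a = 0
           \<and> nderiv l (Delta_plus N a b lam k) b
               = kron k l * of_real (lam powr (real l / (2 * real N))) * Delta N a b lam)
       \<and> (\<forall>u. solves_bvp N lam a b
               (\<lambda>l. 0)
               (\<lambda>l. kron k l * of_real (lam powr (real l / (2 * real N))) * Delta N a b lam) u
             \<longrightarrow> (\<forall>x\<in>{a<..<b}. u x = Delta_plus N a b lam k x)))"
proof -
  define n where "n = 2 * N"
  define w where "w = lam powr (1 / (2 * real N))"
  define \<rho> where "\<rho> = of_real w * theta N 1"
  define \<omega> where "\<omega> = exp (2 * of_real pi * \<i> / of_nat (2 * N))"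
  define A where "A = Delta_mat N a b lam"
  define C where "C r c = cofactor A r c" for r c
  define D where "D r x = Determinant.det (Delta_mat_repl N a b lam r x)" for r x
  have N: "N > 0" using \<open>N \<ge> 2\<close> by simp
  interpret binomial_ode n \<rho> \<omega>
    unfolding n_def \<rho>_def w_def \<omega>_def using N \<open>lam > 0\<close> by (rule binomial_ode_theta)
  have index_less: "k < n" "N + k < n" if "k < N" for k
    using that by (simp_all add: n_def)
  have w0: "w > 0" using \<open>lam > 0\<close> by (simp add: w_def)
  have w_powr: "lam powr (real k / (2 * real N)) = w ^ k" for k
    using \<open>lam > 0\<close> by (simp add: w_def powr_power)
  have w_powr_minus: "lam powr (- (real k / (2 * real N))) = 1 / w ^ k" for k
    by (simp add: powr_minus_divide w_powr)
  have wn: "w ^ n = lam" using w_powr[of n] N \<open>lam > 0\<close> by (simp add: n_def)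
  have \<rho>n: "\<rho> ^ n = (- 1) ^ (N - 1) * of_real lam"
    using theta_power[OF N] wn by (simp add: \<rho>_def power_mult_distrib n_def flip: of_real_power)
  have chr: "char_root l = of_real w * theta N (Suc l)" for l
    unfolding char_root_def theta_Suc[OF N, of l] unfolding \<rho>_def \<omega>_def by (rule mult.assoc)
  have e: "e_lam N lam (theta N (Suc l) * of_real x) = exp (char_root l * of_real x)" for l x
    by (simp add: e_lam_def chr w_def mult.assoc)
  have A: "A \<in> carrier_mat n n" by (simp add: A_def Delta_mat_def n_def)
  have entries: "A $$ (k, l) = theta N (Suc l) ^ k * exp (char_root l * of_real a)"
    "A $$ (N + k, l) = theta N (Suc l) ^ k * exp (char_root l * of_real b)" if "k < N" "l < n" for k l
    using that by (simp_all add: A_def Delta_mat_def n_def e)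
  have chr_power: "char_root l ^ k = of_real w ^ k * theta N (Suc l) ^ k" for k l
    by (simp only: chr power_mult_distrib)
  have rows: "exp_sum c k a = of_real w ^ k * (\<Sum>l<n. A $$ (k, l) * c l)"
    "exp_sum c k b = of_real w ^ k * (\<Sum>l<n. A $$ (N + k, l) * c l)" if "k < N" for c k
    using that unfolding exp_sum_def sum_distrib_left
    by (auto intro!: sum.cong simp: entries chr_power mult_ac simp del: of_real_power)
  have D: "D r = exp_sum (C r) 0" if "r < n" for r
  proof
    fix x
    have "D r x = (\<Sum>l<n. exp (char_root l * of_real x) * C r l)"
      unfolding D_def Delta_mat_repl_def C_def n_def [symmetric] A_def [symmetric] e
      by (rule det_replace_row[OF A that])
    then show "D r x = exp_sum (C r) 0 x" by (simp add: exp_sum_def mult.commute)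
  qed
  have bdry_a: "exp_sum (C r) k a = (if k = r then of_real w ^ k * Determinant.det A else 0)"
    and bdry_b: "exp_sum (C r) k b = (if N + k = r then of_real w ^ k * Determinant.det A else 0)"
    if "r < n" "k < N" for r k
    using that sum_row_cofactor[OF A, of k r] sum_row_cofactor[OF A, of "N + k" r]
    by (simp_all add: rows C_def index_less)
  have det: "Determinant.det A \<noteq> 0"
  proof
    assume "Determinant.det A = 0"
    then obtain v where v: "v \<in> carrier_vec n" "v \<noteq> 0\<^sub>v n" "A *\<^sub>v v = 0\<^sub>v n"
      using det_0_iff_vec_prod_zero[OF A] by auto
    have Av: "(\<Sum>l<n. A $$ (i, l) * v $ l) = 0" if "i < n" for i
      using arg_cong[OF v(3), of "\<lambda>u. u $ i"] that A v(1)
      by (simp add: scalar_prod_def atLeast0LessThan)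
    have "v $ l = 0" if "l < n" for l
      by (rule zero_boundary_data_imp_zero[OF n_def \<open>lam > 0\<close> \<rho>n \<open>a < b\<close>])
         (use Av that in \<open>simp_all add: rows index_less\<close>)
    then show False using v by auto
  qed
  have Delta: "Delta N a b lam = Determinant.det A" by (simp add: Delta_def A_def)
  have minus: "Delta_minus N a b lam k = exp_sum (C k) 0" if "k < N" for k
    using D[of k] index_less that by (simp add: Delta_minus_def [abs_def] D_def [abs_def])
  have plus: "Delta_plus N a b lam k = exp_sum (C (N + k)) 0" if "k < N" for k
    using D[of "N + k"] index_less that by (simp add: Delta_plus_def [abs_def] D_def [abs_def])
  note unique = bvp_solution_unique[OF n_def \<open>lam > 0\<close> \<rho>n \<open>a < b\<close>]
  have ode: "nderiv (2 * N) (exp_sum c 0) x = of_real (kap N * lam) * exp_sum c 0 x" for c x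
    using exp_sum_periodic[of c 0 x] by (simp add: nderiv_exp_sum n_def [symmetric] \<rho>n kap_def)
  have range: "{0..N-1} = {..<N}" using N by auto
  have formula: "feynman_kac p a b lam \<phi> x =
         (\<Sum>k=0..N-1. of_real (lam powr (- (real k / (2 * real N))))
            * (Delta_minus N a b lam k x / Delta N a b lam) * nderiv k \<phi> a)
       + (\<Sum>k=0..N-1. of_real (lam powr (- (real k / (2 * real N))))
            * (Delta_plus N a b lam k x / Delta N a b lam) * nderiv k \<phi> b)"
    if x: "x \<in> {a<..<b}" for x
  proof -
    define s where "s \<psi> k = \<psi> k / (of_real w ^ k * Determinant.det A)" for \<psi> :: "nat \<Rightarrow> complex" and k
    \<comment> \<open>the coefficients of the right-hand side: data divided by the boundary value
      \<open>w ^ k * \<Delta>\<close> of the corresponding replaced determinant\<close>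
    define c where "c l = (\<Sum>k<N. s (\<lambda>k. nderiv k \<phi> a) k * C k l)
                        + (\<Sum>k<N. s (\<lambda>k. nderiv k \<phi> b) k * C (N + k) l)" for l
    have c: "exp_sum c j y = (\<Sum>k<N. s (\<lambda>k. nderiv k \<phi> a) k * exp_sum (C k) j y)
                        + (\<Sum>k<N. s (\<lambda>k. nderiv k \<phi> b) k * exp_sum (C (N + k)) j y)" for j y
      unfolding c_def [abs_def] by (simp only: exp_sum_add exp_sum_linear_combination)
    have s: "s \<psi> k * (if j = k then of_real w ^ j * Determinant.det A else 0) = (if k = j then \<psi> k else 0)"
      for \<psi> j k
      using w0 det by (auto simp: s_def)
    have "feynman_kac p a b lam \<phi> x = exp_sum c 0 x"
    proof (rule unique[OF assms(7) _ _ x])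
      fix j assume j: "j < N"
      have "exp_sum c j a = (\<Sum>k<N. if k = j then nderiv k \<phi> a else 0)"
        unfolding c using j by (simp add: bdry_a index_less s)
      then show "exp_sum c j a = nderiv j \<phi> a" using j by simp
      have "exp_sum c j b = (\<Sum>k<N. if k = j then nderiv k \<phi> b else 0)"
        unfolding c using j by (simp add: bdry_b index_less s)
      then show "exp_sum c j b = nderiv j \<phi> b" using j by simp
    qed
    with range show ?thesis
      unfolding w_powr_minus by (simp add: c s_def Delta minus plus mult_ac)
  qed
  have bvp_minus: "nderiv l (Delta_minus N a b lam k) a
        = kron k l * of_real (lam powr (real l / (2 * real N))) * Delta N a b lam"
      "nderiv l (Delta_minus N a b lam k) b = 0"
    and bvp_plus: "nderiv l (Delta_plus N a b lam k) a = 0"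
      "nderiv l (Delta_plus N a b lam k) b
        = kron k l * of_real (lam powr (real l / (2 * real N))) * Delta N a b lam"
    if "k < N" "l < N" for k l
    unfolding w_powr using that
    by (simp_all add: minus plus nderiv_exp_sum bdry_a bdry_b index_less Delta kron_def)
  have unique_minus: "u x = Delta_minus N a b lam k x"
    if "solves_bvp N lam a b
          (\<lambda>l. kron k l * of_real (lam powr (real l / (2 * real N))) * Delta N a b lam) (\<lambda>l. 0) u"
      "k < N" "x \<in> {a<..<b}" for u k x
    using unique[OF that(1), of "C k" x] that bvp_minus[OF \<open>k < N\<close>]
    by (simp add: minus nderiv_exp_sum)
  have unique_plus: "u x = Delta_plus N a b lam k x"
    if "solves_bvp N lam a b (\<lambda>l. 0)
          (\<lambda>l. kron k l * of_real (lam powr (real l / (2 * real N))) * Delta N a b lam) u"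
      "k < N" "x \<in> {a<..<b}" for u k x
    using unique[OF that(1), of "C (N + k)" x] that bvp_plus[OF \<open>k < N\<close>]
    by (simp add: plus nderiv_exp_sum)
  have ode_minus: "ndiff_on (2 * N) (Delta_minus N a b lam k) UNIV"
      "nderiv (2 * N) (Delta_minus N a b lam k) x = of_real (kap N * lam) * Delta_minus N a b lam k x"
    and ode_plus: "ndiff_on (2 * N) (Delta_plus N a b lam k) UNIV"
      "nderiv (2 * N) (Delta_plus N a b lam k) x = of_real (kap N * lam) * Delta_plus N a b lam k x"
    if "k < N" for k x
    using that by (simp_all only: minus plus ode ndiff_on_exp_sum)
  show ?thesis
    unfolding range
  proof (intro conjI ballI allI impI)
    show "Delta N a b lam \<noteq> 0" using det Delta by simp
  qed (simp_all only: lessThan_iff formula[unfolded range] ode_minus ode_plus bvp_minus bvp_plus,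
      auto intro: unique_minus unique_plus)
qed

end
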